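(* Let $\Gamma$ be a semi-equivelar gem (of some closed connected PL $d$-manifold, $d\ge 2$), embedded regularly on a surface $S$ with $\chi(S)=0$ (so that the face-cycles at all vertices of this embedding are of the same type). Then $\Gamma$ is of type $(4^4)$, $(6^3)$, $(8^2,4^1)$ or $(4,6,12)$.
   Context: Colored graphs and gems. Let $d\ge 2$ and $\Delta_d=\{0,1,\dots,d\}$. A regular $(d+1)$-colored graph $(\Gamma,\gamma)$ is a finite loopless multigraph $\Gamma$ in which every vertex has degree $d+1$, with a surjective proper edge-coloring $\gamma:E(\Gamma)\to\Delta_d$ (adjacent edges get different colors). Its simplicial cell-complex $\mathcal K(\Gamma)$ is built by taking one $d$-simplex $\sigma(u)$ with vertices labeled by $\Delta_d$ for each vertex $u$ of $\Gamma$, and, for each edge of color $j$ between $u$ and $v$, identifying the $(d-1)$-faces of $\sigma(u)$ and $\sigma(v)$ opposite to the $j$-labeled vertices so that equally labeled vertices coincide. If $|\mathcal K(\Gamma)|$ is PL homeomorphic to a closed connected PL $d$-manifold $M$, then $\Gamma$ is called a gem of $M$ (it represents $M$). Regular embedding. For a cyclic permutation $\varepsilon=(\varepsilon_0,\dots,\varepsilon_d)$ of $\Delta_d$, a regular embedding of $\Gamma$ on a closed surface $S$ is a (2-cell) embedding whose faces are bounded exactly by the bi-colored cycles of $\Gamma$ with colors $\varepsilon_i,\varepsilon_{i+1}$ (indices mod $d+1$). Thus every face is an even-length polygon; $S$ is orientable if $\Gamma$ is bipartite and non-orientable otherwise. Semi-equivelar gem. For a regular embedding of $\Gamma$ on $S$,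 each vertex has a face-cycle $P_0,\dots,P_d$ (the faces around it in cyclic order); two face-cycles are of the same type if their sequences of face lengths agree up to cyclic shift (a face-cycle may be read in either direction). $\Gamma$ is a semi-equivelar gem of $M$, embedded regularly on $S$, if it is a gem of $M$ with a regular embedding on $S$ in which every face has length at least $4$ and the face-cycles at all vertices are of the same type. It is of type $(p_0,\dots,p_d)$ if $P_i$ is a $p_i$-gon; an exponent $p_i^{n_i}$ means $n_i$ adjacent $p_i$-gons. *)

theory Defs
  imports "HOL-Analysis.Analysis"
begin

section \<open>Colored graphs\<close>

text \<open>Multigraphs: parallel edges are distinct elements of the edge set with the same ends.\<close>

record ('v, 'e) colored_graph =
  verts :: "'v set"
  edges :: "'e set"
  ends :: "'e \<Rightarrow> 'v set"
  color :: "'e \<Rightarrow> nat"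

definition regular_colored_graph :: "nat \<Rightarrow> ('v, 'e) colored_graph \<Rightarrow> bool" where
  "regular_colored_graph d G \<longleftrightarrow>
     finite (verts G) \<and> finite (edges G) \<and>
     (\<forall>e\<in>edges G. ends G e \<subseteq> verts G \<and> card (ends G e) = 2) \<and>
     (\<forall>v\<in>verts G. card {e \<in> edges G. v \<in> ends G e} = d + 1) \<and>
     color G ` edges G = {0..d} \<and>
     (\<forall>e\<in>edges G. \<forall>f\<in>edges G.
        e \<noteq> f \<and> ends G e \<inter> ends G f \<noteq> {} \<longrightarrow> color G e \<noteq> color G f)"

definition bicolored_edges :: "('v, 'e) colored_graph \<Rightarrow> nat \<Rightarrow> nat \<Rightarrow> 'e set" where
  "bicolored_edges G a b = {e \<in> edges G. color G e \<in> {a, b}}"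

definition bicolored_adjacent :: "('v, 'e) colored_graph \<Rightarrow> nat \<Rightarrow> nat \<Rightarrow> ('e \<times> 'e) set" where
  "bicolored_adjacent G a b =
     {(e, f). e \<in> bicolored_edges G a b \<and> f \<in> bicolored_edges G a b \<and> ends G e \<inter> ends G f \<noteq> {}}"

text \<open>The components of the subgraph spanned by the edges of two colors \<open>a \<noteq> b\<close> are cycles, as this
  subgraph is 2-regular. A bi-colored cycle is represented by its set of edges, so that its
  length is the cardinality of that set.\<close>

definition bicolored_cycles :: "('v, 'e) colored_graph \<Rightarrow> nat \<Rightarrow> nat \<Rightarrow> 'e set set" where
  "bicolored_cycles G a b = bicolored_edges G a b // (bicolored_adjacent G a b)\<^sup>*"


section \<open>PL maps and closed PL manifolds\<close>

text \<open>Polyhedra and PL maps in the local sense: near each point, \<open>U\<close> is a finite union of convex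
  polytopes, on each of which \<open>f\<close> is affine. The polytopes being closed and covering a neighborhood,
  \<open>f\<close> is then continuous.\<close>

definition pl_on :: "'a::euclidean_space set \<Rightarrow> ('a \<Rightarrow> 'b::euclidean_space) \<Rightarrow> bool" where
  "pl_on U f \<longleftrightarrow>
     (\<forall>a\<in>U. \<exists>\<P> N. finite \<P> \<and>
        (\<forall>P\<in>\<P>. polytope P \<and> P \<subseteq> U \<and> (\<exists>g c. linear g \<and> (\<forall>x\<in>P. f x = g x + c))) \<and>
        openin (top_of_set U) N \<and> a \<in> N \<and> N \<subseteq> \<Union>\<P>)"

definition pl_homeomorphic :: "'a::euclidean_space set \<Rightarrow> 'b::euclidean_space set \<Rightarrow> bool" where
  "pl_homeomorphic U W \<longleftrightarrow> (\<exists>f g. homeomorphism U W f g \<and> pl_on U f \<and> pl_on W g)"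

text \<open>Closed (compact, without boundary) connected PL \<open>d\<close>-manifolds as subsets of some Euclidean
  space. The model space of the charts is any \<open>d\<close>-dimensional linear subspace \<open>L\<close> of the ambient
  space, which is linearly isomorphic to the standard \<open>d\<close>-dimensional Euclidean space.\<close>

definition closed_connected_pl_manifold :: "nat \<Rightarrow> 'm::euclidean_space set \<Rightarrow> bool" where
  "closed_connected_pl_manifold d M \<longleftrightarrow>
     M \<noteq> {} \<and> compact M \<and> connected M \<and>
     (\<forall>x\<in>M. \<exists>U (L :: 'm set) W. openin (top_of_set M) U \<and> x \<in> U \<and>
        subspace L \<and> dim L = d \<and> openin (top_of_set L) W \<and> pl_homeomorphic U W)"


section \<open>The simplicial cell-complex of a colored graph, and gems\<close>

definition quotient_topology :: "'a topology \<Rightarrow> ('a \<Rightarrow> 'b) \<Rightarrow> 'b topology" where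
  "quotient_topology X q =
     topology (\<lambda>T. T \<subseteq> q ` topspace X \<and> openin X {x \<in> topspace X. q x \<in> T})"

lemma istopology_quotient:
  "istopology (\<lambda>T. T \<subseteq> q ` topspace X \<and> openin X {x \<in> topspace X. q x \<in> T})"
proof -
  have *: "{x \<in> topspace X. q x \<in> S \<inter> T} = {x \<in> topspace X. q x \<in> S} \<inter> {x \<in> topspace X. q x \<in> T}"
    for S T by auto
  have **: "{x \<in> topspace X. q x \<in> \<Union>\<K>} = \<Union>((\<lambda>T. {x \<in> topspace X. q x \<in> T}) ` \<K>)" for \<K>
    by auto
  show ?thesis
    unfolding istopology_def * ** by (auto intro!: openin_Union)
qed

lemma openin_quotient_topology:
  "openin (quotient_topology X q) T \<longleftrightarrow>
     T \<subseteq> q ` topspace X \<and> openin X {x \<in> topspace X. q x \<in> T}"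
  unfolding quotient_topology_def by (simp add: istopology_quotient)

lemma quotient_map_quotient_topology: "quotient_map X (quotient_topology X q) q"
proof -
  have "{x \<in> topspace X. q x \<in> q ` topspace X} = topspace X"
    by auto
  then have "openin (quotient_topology X q) (q ` topspace X)"
    by (simp add: openin_quotient_topology)
  moreover have "topspace (quotient_topology X q) \<subseteq> q ` topspace X"
    using openin_topspace[of "quotient_topology X q"] unfolding openin_quotient_topology by blast
  ultimately have "topspace (quotient_topology X q) = q ` topspace X"
    using openin_subset by blast
  then show ?thesis
    by (simp add: quotient_map_def openin_quotient_topology)
qed

definition labeled_simplex :: "nat \<Rightarrow> (nat \<Rightarrow> 'a::euclidean_space) \<Rightarrow> bool" where
  "labeled_simplex d w \<longleftrightarrow> inj_on w {0..d} \<and> \<not> affine_dependent (w ` {0..d})"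

text \<open>The simplex \<open>\<sigma>(u)\<close> is \<open>{u} \<times> convex hull (w ` {0..d})\<close>, its vertex with label \<open>i\<close> being
  \<open>(u, w i)\<close>; an edge of color \<open>j\<close> glues the faces opposite to the vertices with label \<open>j\<close> by the
  affine map preserving labels.\<close>

definition face_glue ::
  "('v, 'e) colored_graph \<Rightarrow> nat \<Rightarrow> (nat \<Rightarrow> 'a::euclidean_space) \<Rightarrow> (('v \<times> 'a) \<times> ('v \<times> 'a)) set" where
  "face_glue G d w =
     {((u, x), (v, x)) | u v x. \<exists>e\<in>edges G. ends G e = {u, v} \<and>
        x \<in> convex hull (w ` ({0..d} - {color G e}))}"

definition cell_complex_point ::
  "('v, 'e) colored_graph \<Rightarrow> nat \<Rightarrow> (nat \<Rightarrow> 'a::euclidean_space) \<Rightarrow> 'v \<times> 'a \<Rightarrow> ('v \<times> 'a) set" where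
  "cell_complex_point G d w p = (face_glue G d w)\<^sup>* `` {p}"

definition cell_complex_space ::
  "('v, 'e) colored_graph \<Rightarrow> nat \<Rightarrow> (nat \<Rightarrow> 'a::euclidean_space) \<Rightarrow> ('v \<times> 'a) set topology" where
  "cell_complex_space G d w =
     quotient_topology
       (prod_topology (discrete_topology (verts G)) (top_of_set (convex hull (w ` {0..d}))))
       (cell_complex_point G d w)"

text \<open>A PL homeomorphism from the cell-complex is a homeomorphism that is PL on every simplex. The
  labeled simplex is placed in the ambient space of \<open>M\<close>, which has room for it whenever \<open>M\<close> is a
  \<open>d\<close>-manifold; its position is irrelevant.\<close>

definition gem_of :: "('v, 'e) colored_graph \<Rightarrow> nat \<Rightarrow> 'm::euclidean_space set \<Rightarrow> bool" where
  "gem_of G d M \<longleftrightarrow>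
     regular_colored_graph d G \<and> closed_connected_pl_manifold d M \<and>
     (\<exists>(w :: nat \<Rightarrow> 'm) h. labeled_simplex d w \<and>
        homeomorphic_map (cell_complex_space G d w) (top_of_set M) h \<and>
        (\<forall>u\<in>verts G. pl_on (convex hull (w ` {0..d})) (\<lambda>x. h (cell_complex_point G d w (u, x)))))"


section \<open>Closed surfaces and the Euler characteristic\<close>

definition closed_surface :: "'s topology \<Rightarrow> bool" where
  "closed_surface S \<longleftrightarrow>
     topspace S \<noteq> {} \<and> compact_space S \<and> connected_space S \<and> Hausdorff_space S \<and>
     (\<forall>x\<in>topspace S. \<exists>U. openin S U \<and> x \<in> U \<and> subtopology S U homeomorphic_space Euclidean_space 2)"

definition disc :: "nat \<Rightarrow> (nat \<Rightarrow> real) set" where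
  "disc n = {x \<in> topspace (Euclidean_space n). (\<Sum>i<n. (x i)\<^sup>2) \<le> 1}"

definition open_disc :: "nat \<Rightarrow> (nat \<Rightarrow> real) set" where
  "open_disc n = {x \<in> topspace (Euclidean_space n). (\<Sum>i<n. (x i)\<^sup>2) < 1}"

definition disc_boundary :: "nat \<Rightarrow> (nat \<Rightarrow> real) set" where
  "disc_boundary n = {x \<in> topspace (Euclidean_space n). (\<Sum>i<n. (x i)\<^sup>2) = 1}"

text \<open>Finite CW structures on \<open>X\<close>, given by the pairs \<open>(k, c)\<close> of a dimension and an open cell.\<close>

definition finite_cw_structure :: "'s topology \<Rightarrow> (nat \<times> 's set) set \<Rightarrow> bool" where
  "finite_cw_structure X \<C> \<longleftrightarrow>
     Hausdorff_space X \<and> finite \<C> \<and>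
     (\<Union>(k, c)\<in>\<C>. c) = topspace X \<and>
     (\<forall>(k, c)\<in>\<C>. \<forall>(l, c')\<in>\<C>. (k, c) \<noteq> (l, c') \<longrightarrow> c \<inter> c' = {}) \<and>
     (\<forall>(k, c)\<in>\<C>. \<exists>\<phi>.
        continuous_map (subtopology (Euclidean_space k) (disc k)) X \<phi> \<and>
        embedding_map (subtopology (Euclidean_space k) (open_disc k)) X \<phi> \<and>
        \<phi> ` open_disc k = c \<and>
        \<phi> ` disc_boundary k \<subseteq> \<Union>{c'. \<exists>l<k. (l, c') \<in> \<C>})"

text \<open>The Euler characteristic of \<open>X\<close>: the alternating sum of the numbers of cells, which is the
  same for all finite CW structures on \<open>X\<close>.\<close>

definition has_euler_characteristic :: "'s topology \<Rightarrow> int \<Rightarrow> bool" where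
  "has_euler_characteristic X n \<longleftrightarrow>
     (\<exists>\<C>. finite_cw_structure X \<C>) \<and>
     (\<forall>\<C>. finite_cw_structure X \<C> \<longrightarrow> (\<Sum>(k, c)\<in>\<C>. (- 1) ^ k) = n)"


section \<open>Regular embeddings\<close>

text \<open>An embedding of the graph is given by the images \<open>\<phi> v\<close> of the vertices and the arcs \<open>\<eta> e\<close>
  representing the edges, which are parametrized by the unit interval.\<close>

definition graph_embedding ::
  "('v, 'e) colored_graph \<Rightarrow> 's topology \<Rightarrow> ('v \<Rightarrow> 's) \<Rightarrow> ('e \<Rightarrow> real \<Rightarrow> 's) \<Rightarrow> bool" where
  "graph_embedding G S \<phi> \<eta> \<longleftrightarrow>
     \<phi> ` verts G \<subseteq> topspace S \<and> inj_on \<phi> (verts G) \<and>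
     (\<forall>e\<in>edges G. embedding_map (top_of_set {0..1}) S (\<eta> e) \<and>
        {\<eta> e 0, \<eta> e 1} = \<phi> ` ends G e \<and> \<eta> e ` {0<..<1} \<inter> \<phi> ` verts G = {}) \<and>
     (\<forall>e\<in>edges G. \<forall>f\<in>edges G. e \<noteq> f \<longrightarrow> \<eta> e ` {0<..<1} \<inter> \<eta> f ` {0<..<1} = {})"

definition embedded_edges :: "('e \<Rightarrow> real \<Rightarrow> 's) \<Rightarrow> 'e set \<Rightarrow> 's set" where
  "embedded_edges \<eta> C = (\<Union>e\<in>C. \<eta> e ` {0..1})"

text \<open>As every vertex lies on an edge, the embedded graph is the union of the closed arcs.\<close>

definition regions :: "('v, 'e) colored_graph \<Rightarrow> 's topology \<Rightarrow> ('e \<Rightarrow> real \<Rightarrow> 's) \<Rightarrow> 's set set" where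
  "regions G S \<eta> =
     connected_components_of (subtopology S (topspace S - embedded_edges \<eta> (edges G)))"

text \<open>The region \<open>F\<close> is an open 2-cell whose boundary, traversed once, is the simple closed
  curve \<open>A\<close>.\<close>

definition cell_bounded_by :: "'s topology \<Rightarrow> 's set \<Rightarrow> 's set \<Rightarrow> bool" where
  "cell_bounded_by S F A \<longleftrightarrow>
     (\<exists>\<psi>. embedding_map (subtopology (Euclidean_space 2) (disc 2)) S \<psi> \<and>
        \<psi> ` open_disc 2 = F \<and> \<psi> ` disc_boundary 2 = A)"

definition face_boundaries :: "nat \<Rightarrow> ('v, 'e) colored_graph \<Rightarrow> (nat \<Rightarrow> nat) \<Rightarrow> 'e set set" where
  "face_boundaries d G \<epsilon> = (\<Union>i\<in>{0..d}. bicolored_cycles G (\<epsilon> i) (\<epsilon> ((i + 1) mod (d + 1))))"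

definition regular_embedding ::
  "nat \<Rightarrow> ('v, 'e) colored_graph \<Rightarrow> 's topology \<Rightarrow> (nat \<Rightarrow> nat) \<Rightarrow> ('v \<Rightarrow> 's) \<Rightarrow> ('e \<Rightarrow> real \<Rightarrow> 's) \<Rightarrow> bool"
  where
  "regular_embedding d G S \<epsilon> \<phi> \<eta> \<longleftrightarrow>
     closed_surface S \<and> bij_betw \<epsilon> {0..d} {0..d} \<and> graph_embedding G S \<phi> \<eta> \<and>
     (\<exists>F. bij_betw F (face_boundaries d G \<epsilon>) (regions G S \<eta>) \<and>
        (\<forall>C\<in>face_boundaries d G \<epsilon>. cell_bounded_by S (F C) (embedded_edges \<eta> C)))"


section \<open>Face-cycles and semi-equivelar gems\<close>

text \<open>In a regular embedding each face is identified with the bi-colored cycle bounding it. The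
  faces at a vertex \<open>v\<close> are in cyclic order around \<open>v\<close> when consecutive ones share an edge at \<open>v\<close>,
  every edge lying on exactly two faces.\<close>

definition face_cycle ::
  "nat \<Rightarrow> ('v, 'e) colored_graph \<Rightarrow> (nat \<Rightarrow> nat) \<Rightarrow> 'v \<Rightarrow> 'e set list \<Rightarrow> bool" where
  "face_cycle d G \<epsilon> v P \<longleftrightarrow>
     distinct P \<and> set P = {C \<in> face_boundaries d G \<epsilon>. \<exists>e\<in>C. v \<in> ends G e} \<and>
     (\<forall>i<length P. \<exists>e \<in> P ! i \<inter> P ! ((i + 1) mod length P). v \<in> ends G e)"

definition same_cyclic_type :: "nat list \<Rightarrow> nat list \<Rightarrow> bool" where
  "same_cyclic_type p q \<longleftrightarrow> (\<exists>n. q = rotate n p \<or> q = rotate n (rev p))"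

definition semi_equivelar_gem ::
  "nat \<Rightarrow> ('v, 'e) colored_graph \<Rightarrow> 'm::euclidean_space set \<Rightarrow> 's topology \<Rightarrow>
     (nat \<Rightarrow> nat) \<Rightarrow> ('v \<Rightarrow> 's) \<Rightarrow> ('e \<Rightarrow> real \<Rightarrow> 's) \<Rightarrow> bool" where
  "semi_equivelar_gem d G M S \<epsilon> \<phi> \<eta> \<longleftrightarrow>
     gem_of G d M \<and> regular_embedding d G S \<epsilon> \<phi> \<eta> \<and>
     (\<forall>C\<in>face_boundaries d G \<epsilon>. card C \<ge> 4) \<and>
     (\<forall>u\<in>verts G. \<forall>v\<in>verts G. \<forall>P Q. face_cycle d G \<epsilon> u P \<and> face_cycle d G \<epsilon> v Q \<longrightarrow>
        same_cyclic_type (map card P) (map card Q))"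

text \<open>The reading direction and the starting face of a face-cycle \<open>P\<close> are arbitrary, so the
  lengths may be required to be literally \<open>p\<close>.\<close>

definition of_type ::
  "nat \<Rightarrow> ('v, 'e) colored_graph \<Rightarrow> (nat \<Rightarrow> nat) \<Rightarrow> nat list \<Rightarrow> bool" where
  "of_type d G \<epsilon> p \<longleftrightarrow> (\<forall>v\<in>verts G. \<exists>P. face_cycle d G \<epsilon> v P \<and> map card P = p)"

end

theory Submission
  imports Defs "HOL-Combinatorics.Permutations"
begin

text \<open>The embedded graph cuts the surface into open cells: the vertices, the open arcs and the regions
  (\<open>finite_cw_structure_embedding_cells\<close>). Euler characteristic zero therefore says \<open>V - E + F = 0\<close> for the
  numbers of vertices, edges and faces. Every vertex has degree \<open>d + 1\<close>, so \<open>2 E = (d + 1) V\<close>.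

  To count faces, note that the edges of either color in a bi-colored cycle form a perfect matching
  of its vertices. Hence the length of the cycle is the number of its vertices, and it is even
  (\<open>card_bicolored_cycle\<close>). Moreover each vertex lies on exactly one cycle for each of the \<open>d + 1\<close> pairs of
  consecutive colors. Letting every face give each of its vertices the share \<open>1 / length\<close>, one obtains
  \<open>F\<close> as the sum over all vertices \<open>v\<close> of \<open>1/p\<^sub>0 + \<dots> + 1/p\<^sub>d\<close>, where the \<open>p\<^sub>i\<close> are the lengths of the
  faces at \<open>v\<close> (\<open>card_face_boundaries\<close>). For a semi-equivelar gem this inner sum is the same at all
  vertices, and so it equals \<open>(d - 1) / 2\<close> (\<open>inverse_length_sum\<close>).

  Since all \<open>p\<^sub>i\<close> are at least 4, the sum is at most \<open>(d + 1) / 4\<close>, which leaves \<open>d = 2\<close> and \<open>d = 3\<close>. For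
  \<open>d = 3\<close> there is equality, so that all faces are squares. For \<open>d = 2\<close> the even numbers \<open>p\<^sub>i \<ge> 4\<close> satisfy
  \<open>1/p\<^sub>0 + 1/p\<^sub>1 + 1/p\<^sub>2 = 1/2\<close>, whose solutions are \<open>{6, 6, 6}\<close>, \<open>{4, 8, 8}\<close> and \<open>{4, 6, 12}\<close>
  (\<open>unit_fractions_sum_half\<close>). Three faces at a vertex are pairwise consecutive, so that they can be
  listed in the order in which the type is written (\<open>face_cycle_of_lengths\<close>).\<close>

section \<open>Edges of a regular colored graph\<close>

lemma regular_colored_graph_ends:
  assumes "regular_colored_graph d G" and "e \<in> edges G"
  shows "ends G e \<subseteq> verts G" and "card (ends G e) = 2" and "finite (ends G e)" and "ends G e \<noteq> {}"
proof -
  show "ends G e \<subseteq> verts G" and c: "card (ends G e) = 2"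
    using assms by (simp_all add: regular_colored_graph_def)
  show "finite (ends G e)" using c by (simp add: card_ge_0_finite)
  show "ends G e \<noteq> {}" using c by force
qed

lemma vertex_on_edge:
  assumes "regular_colored_graph d G" and "v \<in> verts G"
  obtains e where "e \<in> edges G" and "v \<in> ends G e"
proof -
  have "card {e \<in> edges G. v \<in> ends G e} = d + 1"
    using assms by (simp add: regular_colored_graph_def)
  then have "{e \<in> edges G. v \<in> ends G e} \<noteq> {}"
    by (metis Suc_eq_plus1 card.empty nat.distinct(1))
  then show ?thesis using that by blast
qed

definition edge_at :: "('v, 'e) colored_graph \<Rightarrow> 'v \<Rightarrow> nat \<Rightarrow> 'e" where
  "edge_at G v c = (THE e. e \<in> edges G \<and> v \<in> ends G e \<and> color G e = c)"

lemma edge_at_eqI: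
  assumes G: "regular_colored_graph d G" and e: "e \<in> edges G" "v \<in> ends G e"
  shows "edge_at G v (color G e) = e"
  unfolding edge_at_def
proof (rule the_equality)
  fix f assume "f \<in> edges G \<and> v \<in> ends G f \<and> color G f = color G e"
  then show "f = e"
    using G e unfolding regular_colored_graph_def by blast
qed (use e in auto)

text \<open>The \<open>d + 1\<close> edges at a vertex have different colors among the \<open>d + 1\<close> available ones, so every
  color occurs.\<close>
lemma edge_at:
  assumes G: "regular_colored_graph d G" and v: "v \<in> verts G" and c: "c \<le> d"
  shows "edge_at G v c \<in> edges G" "v \<in> ends G (edge_at G v c)" "color G (edge_at G v c) = c"
proof -
  let ?A = "{e \<in> edges G. v \<in> ends G e}"
  have "inj_on (color G) ?A"
    using G unfolding regular_colored_graph_def inj_on_def by blast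
  then have "card (color G ` ?A) = card {0..d}"
    using G v by (simp add: card_image regular_colored_graph_def)
  moreover have "color G ` ?A \<subseteq> {0..d}"
    using G unfolding regular_colored_graph_def by blast
  ultimately have "color G ` ?A = {0..d}"
    by (intro card_subset_eq) auto
  then obtain e where "e \<in> edges G" "v \<in> ends G e" "c = color G e"
    using c by (metis (no_types, lifting) atLeastAtMost_iff imageE mem_Collect_eq zero_le)
  then show "edge_at G v c \<in> edges G" "v \<in> ends G (edge_at G v c)" "color G (edge_at G v c) = c"
    using edge_at_eqI[OF G] by auto
qed

lemma card_edges:
  assumes G: "regular_colored_graph d G"
  shows "2 * card (edges G) = (d + 1) * card (verts G)"
proof -
  have "{v \<in> verts G. v \<in> ends G e} = ends G e" if "e \<in> edges G" for e
    using G that by (auto simp: regular_colored_graph_def)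
  then have "(\<Sum>v\<in>verts G. card {e \<in> edges G. v \<in> ends G e}) = 2 * card (edges G)"
    using G by (intro sum_multicount) (auto simp: regular_colored_graph_def)
  moreover have "(\<Sum>v\<in>verts G. card {e \<in> edges G. v \<in> ends G e}) = (d + 1) * card (verts G)"
    using G by (simp add: regular_colored_graph_def)
  ultimately show ?thesis by simp
qed

lemma verts_nonempty:
  assumes G: "regular_colored_graph d G"
  shows "verts G \<noteq> {}"
proof -
  obtain e where "e \<in> edges G"
    using G unfolding regular_colored_graph_def by (metis atLeastAtMost_iff empty_iff ex_in_conv image_empty le_refl zero_le)
  then show ?thesis
    using regular_colored_graph_ends(1,4)[OF G] by blast
qed

section \<open>Bi-colored cycles\<close>

definition bicolored_cycle_at :: "('v, 'e) colored_graph \<Rightarrow> nat \<Rightarrow> nat \<Rightarrow> 'v \<Rightarrow> 'e set" where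
  "bicolored_cycle_at G a b v = (bicolored_adjacent G a b)\<^sup>* `` {edge_at G v a}"

lemma bicolored_cycle_subset:
  assumes "C \<in> bicolored_cycles G a b"
  shows "C \<subseteq> bicolored_edges G a b"
proof -
  obtain x where x: "x \<in> bicolored_edges G a b" and C: "C = (bicolored_adjacent G a b)\<^sup>* `` {x}"
    using assms by (auto simp: bicolored_cycles_def quotient_def)
  have "y \<in> bicolored_edges G a b" if "(x, y) \<in> (bicolored_adjacent G a b)\<^sup>*" for y
    using that by induction (use x in \<open>auto simp: bicolored_adjacent_def\<close>)
  then show ?thesis using C by auto
qed

lemma sym_bicolored_adjacent_rtrancl: "sym ((bicolored_adjacent G a b)\<^sup>*)"
  by (intro sym_rtrancl) (auto simp: sym_def bicolored_adjacent_def)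

text \<open>A cycle is an equivalence class of edges, so it is determined by any edge in it.\<close>
lemma bicolored_cycle_eqI:
  assumes "C \<in> bicolored_cycles G a b" and "e \<in> C"
  shows "C = (bicolored_adjacent G a b)\<^sup>* `` {e}"
proof -
  obtain x where "C = (bicolored_adjacent G a b)\<^sup>* `` {x}"
    using assms(1) by (auto simp: bicolored_cycles_def quotient_def)
  moreover have "equiv UNIV ((bicolored_adjacent G a b)\<^sup>*)"
    by (intro equivI refl_rtrancl sym_bicolored_adjacent_rtrancl trans_rtrancl) simp
  ultimately show ?thesis
    using assms(2) equiv_class_eq by fastforce
qed

lemma bicolored_cycle_nonempty: "C \<in> bicolored_cycles G a b \<Longrightarrow> C \<noteq> {}"
  by (auto simp: bicolored_cycles_def quotient_def)

lemma bicolored_cycle_at: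
  assumes G: "regular_colored_graph d G" and v: "v \<in> verts G" and a: "a \<le> d"
  shows "bicolored_cycle_at G a b v \<in> bicolored_cycles G a b"
  unfolding bicolored_cycle_at_def bicolored_cycles_def
  by (rule quotientI) (use edge_at[OF G v a] in \<open>simp add: bicolored_edges_def\<close>)

text \<open>A cycle through \<open>v\<close> contains both edges at \<open>v\<close> of its two colors, as these are adjacent.\<close>
lemma edge_at_mem_bicolored_cycle:
  assumes G: "regular_colored_graph d G" and v: "v \<in> verts G"
    and C: "C \<in> bicolored_cycles G a b" and e: "e \<in> C" "v \<in> ends G e"
    and c: "c \<in> {a, b}" "c \<le> d"
  shows "edge_at G v c \<in> C"
proof -
  have "(e, edge_at G v c) \<in> bicolored_adjacent G a b"
    using edge_at[OF G v c(2)] bicolored_cycle_subset[OF C] e c(1)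
    by (auto simp: bicolored_adjacent_def bicolored_edges_def)
  then show ?thesis
    using bicolored_cycle_eqI[OF C e(1)] by auto
qed

text \<open>The vertices of \<open>C\<close> thus form a fiber of \<open>bicolored_cycle_at G a b\<close>, which makes the cycles with
  colors \<open>a\<close> and \<open>b\<close> a partition of the vertex set. This is the basis of the counting below.\<close>
lemma incident_bicolored_cycle_iff:
  assumes G: "regular_colored_graph d G" and v: "v \<in> verts G" and a: "a \<le> d"
    and C: "C \<in> bicolored_cycles G a b"
  shows "(\<exists>e\<in>C. v \<in> ends G e) \<longleftrightarrow> C = bicolored_cycle_at G a b v"
proof
  assume "\<exists>e\<in>C. v \<in> ends G e"
  then have "edge_at G v a \<in> C"
    using edge_at_mem_bicolored_cycle[OF G v C] a by blast
  then show "C = bicolored_cycle_at G a b v"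
    unfolding bicolored_cycle_at_def by (rule bicolored_cycle_eqI[OF C])
next
  assume "C = bicolored_cycle_at G a b v"
  then show "\<exists>e\<in>C. v \<in> ends G e"
    using edge_at[OF G v a] by (auto simp: bicolored_cycle_at_def)
qed

lemma edge_at_mem_bicolored_cycle_at:
  assumes G: "regular_colored_graph d G" and v: "v \<in> verts G"
    and a: "a \<le> d" and c: "c \<in> {a, b}" "c \<le> d"
  shows "edge_at G v c \<in> bicolored_cycle_at G a b v"
proof -
  have C: "bicolored_cycle_at G a b v \<in> bicolored_cycles G a b"
    by (rule bicolored_cycle_at[OF G v a])
  then obtain e where "e \<in> bicolored_cycle_at G a b v" "v \<in> ends G e"
    using incident_bicolored_cycle_iff[OF G v a C] by blast
  then show ?thesis
    using edge_at_mem_bicolored_cycle[OF G v C] c by blast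
qed

text \<open>The pair of colors can be read off from the cycle, so that cycles with different pairs of
  colors are different sets of edges.\<close>
lemma color_bicolored_cycle:
  assumes G: "regular_colored_graph d G" and "a \<le> d" "b \<le> d"
    and C: "C \<in> bicolored_cycles G a b"
  shows "color G ` C = {a, b}"
proof -
  obtain e where e: "e \<in> C" using bicolored_cycle_nonempty[OF C] by blast
  then have "e \<in> edges G" using bicolored_cycle_subset[OF C] by (auto simp: bicolored_edges_def)
  then obtain v where v: "v \<in> ends G e" "v \<in> verts G"
    using regular_colored_graph_ends(1,4)[OF G] by blast
  have "c \<in> color G ` C" if "c \<in> {a, b}" for c
  proof -
    have "c \<le> d" using that assms(2,3) by auto
    then show ?thesis
      using edge_at_mem_bicolored_cycle[OF G v(2) C e v(1) that] edge_at(3)[OF G v(2)]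
      by (metis imageI)
  qed
  then show ?thesis
    using bicolored_cycle_subset[OF C] by (auto simp: bicolored_edges_def)
qed

text \<open>The edges of color \<open>a\<close> in \<open>C\<close> form a perfect matching of the vertices of \<open>C\<close>, and so do the edges of
  color \<open>b\<close>. With \<open>n\<close> vertices there are then \<open>n / 2\<close> edges of each color, and \<open>n\<close> edges altogether. The
  two classes have equal size, whence the parity.\<close>
lemma card_bicolored_cycle:
  assumes G: "regular_colored_graph d G" and a: "a \<le> d" and b: "b \<le> d" and ab: "a \<noteq> b"
    and C: "C \<in> bicolored_cycles G a b"
  shows "card C = card {v \<in> verts G. C = bicolored_cycle_at G a b v}" and "even (card C)"
    and "card C > 0"
proof -
  let ?n = "card {v \<in> verts G. C = bicolored_cycle_at G a b v}"
  have col: "color G e \<in> {a, b}" if "e \<in> C" for e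
    using bicolored_cycle_subset[OF C] that by (auto simp: bicolored_edges_def)
  have CE: "C \<subseteq> edges G"
    using bicolored_cycle_subset[OF C] by (auto simp: bicolored_edges_def)
  then have fin: "finite C"
    by (rule finite_subset) (use G in \<open>simp add: regular_colored_graph_def\<close>)
  \<comment> \<open>The edges of color \<open>c\<close> in the cycle are pairwise disjoint and cover its vertices.\<close>
  have n: "?n = 2 * card {e \<in> C. color G e = c}" if c: "c \<in> {a, b}" for c
  proof -
    let ?M = "{e \<in> C. color G e = c}"
    have cd: "c \<le> d" using c a b by auto
    have "{v \<in> verts G. C = bicolored_cycle_at G a b v} = (\<Union>e\<in>?M. ends G e)"
    proof (intro equalityI subsetI)
      fix v assume "v \<in> {v \<in> verts G. C = bicolored_cycle_at G a b v}"
      then have v: "v \<in> verts G" "C = bicolored_cycle_at G a b v" by auto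
      then have "edge_at G v c \<in> ?M"
        using edge_at_mem_bicolored_cycle_at[OF G v(1) a c cd] edge_at(3)[OF G v(1) cd] by simp
      then show "v \<in> (\<Union>e\<in>?M. ends G e)"
        using edge_at(2)[OF G v(1) cd] by blast
    next
      fix v assume "v \<in> (\<Union>e\<in>?M. ends G e)"
      then obtain e where e: "e \<in> C" "v \<in> ends G e" by blast
      then have "v \<in> verts G" using CE regular_colored_graph_ends(1)[OF G] by blast
      then show "v \<in> {v \<in> verts G. C = bicolored_cycle_at G a b v}"
        using incident_bicolored_cycle_iff[OF G _ a C] e by blast
    qed
    also have "card (\<Union>e\<in>?M. ends G e) = (\<Sum>e\<in>?M. card (ends G e))"
    proof (rule card_UN_disjoint)
      show "\<forall>e\<in>?M. finite (ends G e)"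
        using CE regular_colored_graph_ends(3)[OF G] by blast
      show "\<forall>e\<in>?M. \<forall>f\<in>?M. e \<noteq> f \<longrightarrow> ends G e \<inter> ends G f = {}"
        using CE G unfolding regular_colored_graph_def by blast
    qed (use fin in simp)
    also have "\<dots> = (\<Sum>e\<in>?M. 2)"
      using CE regular_colored_graph_ends(2)[OF G] by (intro sum.cong) auto
    finally show ?thesis by simp
  qed
  have "C = {e \<in> C. color G e = a} \<union> {e \<in> C. color G e = b}"
    using col by auto
  then have "card C = card ({e \<in> C. color G e = a} \<union> {e \<in> C. color G e = b})"
    by simp
  also have "\<dots> = card {e \<in> C. color G e = a} + card {e \<in> C. color G e = b}"
    using ab fin by (intro card_Un_disjoint) auto
  finally show "card C = ?n" "even (card C)"
    using n[of a] n[of b] by auto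
  show "card C > 0"
    using bicolored_cycle_nonempty[OF C] fin by (simp add: card_gt_0_iff)
qed

text \<open>Each cycle distributes the weight 1 equally over its vertices.\<close>
lemma card_bicolored_cycles:
  assumes G: "regular_colored_graph d G" and a: "a \<le> d" and b: "b \<le> d" and ab: "a \<noteq> b"
  shows "real (card (bicolored_cycles G a b)) =
    (\<Sum>v\<in>verts G. 1 / real (card (bicolored_cycle_at G a b v)))"
proof -
  let ?g = "bicolored_cycle_at G a b" and ?\<C> = "bicolored_cycles G a b"
  have fin: "finite (verts G)" "finite ?\<C>"
    using G unfolding bicolored_cycles_def quotient_def
    by (auto simp: regular_colored_graph_def bicolored_edges_def)
  \<comment> \<open>The fiber over \<open>C\<close> consists of \<open>card C\<close> vertices, each of weight \<open>1 / card C\<close>.\<close>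
  have one: "(\<Sum>v | v \<in> verts G \<and> ?g v = C. 1 / real (card (?g v))) = 1" if "C \<in> ?\<C>" for C
  proof -
    note card_C = card_bicolored_cycle[OF G a b ab that]
    have "(\<Sum>v | v \<in> verts G \<and> ?g v = C. 1 / real (card (?g v)))
        = (\<Sum>v | v \<in> verts G \<and> C = ?g v. 1 / real (card C))"
      by (rule sum.cong) auto
    also have "\<dots> = real (card {v \<in> verts G. C = ?g v}) / real (card C)"
      by (simp only: sum_constant times_divide_eq_right mult_1_right)
    also have "\<dots> = 1"
      using card_C(3) unfolding card_C(1)[symmetric] by simp
    finally show ?thesis .
  qed
  have "(\<Sum>C\<in>?\<C>. 1) = (\<Sum>C\<in>?\<C>. \<Sum>v | v \<in> verts G \<and> ?g v = C. 1 / real (card (?g v)))"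
    by (rule sum.cong[OF refl one[symmetric]])
  also have "\<dots> = (\<Sum>v\<in>verts G. 1 / real (card (?g v)))"
    using bicolored_cycle_at[OF G _ a] fin by (intro sum.group) auto
  finally show ?thesis by simp
qed

section \<open>The faces at a vertex\<close>

definition face_at ::
  "nat \<Rightarrow> ('v, 'e) colored_graph \<Rightarrow> (nat \<Rightarrow> nat) \<Rightarrow> 'v \<Rightarrow> nat \<Rightarrow> 'e set" where
  "face_at d G \<epsilon> v i = bicolored_cycle_at G (\<epsilon> i) (\<epsilon> ((i + 1) mod (d + 1))) v"

text \<open>At least three indices are needed: modulo 2, both indices give the same pair.\<close>
lemma consecutive_pair_eq_imp_eq:
  fixes i j :: nat
  assumes "d \<ge> 2" "i \<le> d" "j \<le> d"
    and "{i, (i + 1) mod (d + 1)} = {j, (j + 1) mod (d + 1)}"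
  shows "i = j"
proof -
  have m: "(k + 1) mod (d + 1) = (if k = d then 0 else k + 1)" if "k \<le> d" for k
    using that by auto
  show ?thesis
    using assms(1,4) unfolding m[OF assms(2)] m[OF assms(3)] doubleton_eq_iff
    by (auto split: if_splits)
qed

context
  fixes d :: nat and G :: "('v, 'e) colored_graph" and \<epsilon> :: "nat \<Rightarrow> nat"
  assumes d: "d \<ge> 2" and G: "regular_colored_graph d G" and \<epsilon>: "bij_betw \<epsilon> {0..d} {0..d}"
begin

lemma epsilon_le: "i \<le> d \<Longrightarrow> \<epsilon> i \<le> d"
  using \<epsilon> bij_betwE by fastforce

lemma successor_le: "(i + 1) mod (d + 1) \<le> d"
  using mod_less_divisor[of "d + 1" "i + 1"] by simp

lemma epsilon_successor_neq:
  assumes "i \<le> d" shows "\<epsilon> i \<noteq> \<epsilon> ((i + 1) mod (d + 1))"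
proof
  assume "\<epsilon> i = \<epsilon> ((i + 1) mod (d + 1))"
  then have "i = (i + 1) mod (d + 1)"
    using \<epsilon> successor_le[of i] assms by (auto simp: bij_betw_def inj_on_def)
  then show False
    using assms d by (cases "i = d") auto
qed

lemma bicolored_cycles_consecutive_disjoint:
  assumes "i \<le> d" "j \<le> d"
    and "C \<in> bicolored_cycles G (\<epsilon> i) (\<epsilon> ((i + 1) mod (d + 1)))"
    and "C \<in> bicolored_cycles G (\<epsilon> j) (\<epsilon> ((j + 1) mod (d + 1)))"
  shows "i = j"
proof -
  have col: "color G ` C = \<epsilon> ` {k, (k + 1) mod (d + 1)}"
    if "k \<le> d" "C \<in> bicolored_cycles G (\<epsilon> k) (\<epsilon> ((k + 1) mod (d + 1)))" for k
    unfolding color_bicolored_cycle[OF G epsilon_le[OF that(1)] epsilon_le[OF successor_le] that(2)]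
    by (simp only: image_insert image_empty)
  have "\<epsilon> ` {i, (i + 1) mod (d + 1)} = \<epsilon> ` {j, (j + 1) mod (d + 1)}"
    unfolding col[OF assms(1,3), symmetric] by (rule col[OF assms(2,4)])
  then have "{i, (i + 1) mod (d + 1)} = {j, (j + 1) mod (d + 1)}"
  proof (rule inj_on_image_eq_iff[THEN iffD1, rotated 3])
    show "inj_on \<epsilon> {0..d}"
      using \<epsilon> by (rule bij_betw_imp_inj_on)
    show "{i, (i + 1) mod (d + 1)} \<subseteq> {0..d}" "{j, (j + 1) mod (d + 1)} \<subseteq> {0..d}"
      unfolding insert_subset using assms(1,2) successor_le by (simp_all only: atLeastAtMost_iff zero_le empty_subsetI simp_thms)
  qed
  then show ?thesis
    by (rule consecutive_pair_eq_imp_eq[OF d assms(1,2)])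
qed

lemma face_at_bicolored_cycle:
  assumes "v \<in> verts G" "i \<le> d"
  shows "face_at d G \<epsilon> v i \<in> bicolored_cycles G (\<epsilon> i) (\<epsilon> ((i + 1) mod (d + 1)))"
  unfolding face_at_def by (rule bicolored_cycle_at[OF G assms(1) epsilon_le[OF assms(2)]])

lemma face_at_face_boundary:
  assumes "v \<in> verts G" "i \<le> d"
  shows "face_at d G \<epsilon> v i \<in> face_boundaries d G \<epsilon>"
  unfolding face_boundaries_def
  by (rule UN_I[of i]) (use assms face_at_bicolored_cycle[OF assms] in simp_all)

lemma inj_on_face_at:
  assumes "v \<in> verts G"
  shows "inj_on (face_at d G \<epsilon> v) {0..d}"
proof (rule inj_onI)
  fix i j assume ij: "i \<in> {0..d}" "j \<in> {0..d}" "face_at d G \<epsilon> v i = face_at d G \<epsilon> v j"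
  then have le: "i \<le> d" "j \<le> d" by auto
  show "i = j"
    using bicolored_cycles_consecutive_disjoint[OF le face_at_bicolored_cycle[OF assms le(1)]]
      face_at_bicolored_cycle[OF assms le(2)] ij(3) by simp
qed

lemma faces_at_vertex:
  assumes v: "v \<in> verts G"
  shows "{C \<in> face_boundaries d G \<epsilon>. \<exists>e\<in>C. v \<in> ends G e} = face_at d G \<epsilon> v ` {0..d}"
proof (intro equalityI subsetI)
  fix C assume "C \<in> {C \<in> face_boundaries d G \<epsilon>. \<exists>e\<in>C. v \<in> ends G e}"
  then obtain i where i: "i \<in> {0..d}" "C \<in> bicolored_cycles G (\<epsilon> i) (\<epsilon> ((i + 1) mod (d + 1)))"
    "\<exists>e\<in>C. v \<in> ends G e"
    by (auto simp: face_boundaries_def)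
  then show "C \<in> face_at d G \<epsilon> v ` {0..d}"
    using incident_bicolored_cycle_iff[OF G v epsilon_le i(2)] by (auto simp: face_at_def)
next
  fix C assume "C \<in> face_at d G \<epsilon> v ` {0..d}"
  then obtain i where i: "i \<le> d" "C = face_at d G \<epsilon> v i" by auto
  then show "C \<in> {C \<in> face_boundaries d G \<epsilon>. \<exists>e\<in>C. v \<in> ends G e}"
    using incident_bicolored_cycle_iff[OF G v epsilon_le[OF i(1)] face_at_bicolored_cycle[OF v i(1)]]
      face_at_face_boundary[OF v i(1)] by (auto simp: face_at_def)
qed

lemma consecutive_faces_share_edge:
  assumes v: "v \<in> verts G" and i: "i \<le> d"
  shows "\<exists>e \<in> face_at d G \<epsilon> v i \<inter> face_at d G \<epsilon> v ((i + 1) mod (d + 1)). v \<in> ends G e"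
proof -
  let ?j = "(i + 1) mod (d + 1)"
  have "edge_at G v (\<epsilon> ?j) \<in> face_at d G \<epsilon> v i" "edge_at G v (\<epsilon> ?j) \<in> face_at d G \<epsilon> v ?j"
    unfolding face_at_def
    by (intro edge_at_mem_bicolored_cycle_at[OF G v] epsilon_le successor_le i; simp)+
  then show ?thesis
    using edge_at(2)[OF G v epsilon_le[OF successor_le]] by blast
qed

text \<open>Going through the colors in the order of \<open>\<epsilon>\<close> goes once around the vertex: the faces number \<open>i\<close> and
  \<open>i + 1\<close> meet in the edge of color \<open>\<epsilon> (i + 1)\<close>.\<close>
lemma face_cycle_face_at:
  assumes v: "v \<in> verts G"
  shows "face_cycle d G \<epsilon> v (map (face_at d G \<epsilon> v) [0..<d + 1])"
proof -
  have s: "set [0..<d + 1] = {0..d}" by auto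
  have "distinct (map (face_at d G \<epsilon> v) [0..<d + 1])"
    unfolding distinct_map s using inj_on_face_at[OF v] by simp
  moreover have "set (map (face_at d G \<epsilon> v) [0..<d + 1]) = {C \<in> face_boundaries d G \<epsilon>. \<exists>e\<in>C. v \<in> ends G e}"
    unfolding set_map s faces_at_vertex[OF v] ..
  moreover have "\<exists>e \<in> map (face_at d G \<epsilon> v) [0..<d + 1] ! i \<inter>
      map (face_at d G \<epsilon> v) [0..<d + 1] ! ((i + 1) mod (d + 1)). v \<in> ends G e" if "i < d + 1" for i
  proof -
    have "i < length [0..<d + 1]" "(i + 1) mod (d + 1) < length [0..<d + 1]"
      using that by (simp_all del: upt_Suc)
    then show ?thesis
      using consecutive_faces_share_edge[OF v, of i] that
      by (simp del: upt_Suc add: nth_upt)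
  qed
  ultimately show ?thesis
    unfolding face_cycle_def by (simp del: upt_Suc)
qed

text \<open>The double count of incidences between vertices and faces, in which a vertex gets the share
  \<open>1 / length\<close> of each face at it.\<close>
lemma card_face_boundaries:
  "real (card (face_boundaries d G \<epsilon>)) =
    (\<Sum>v\<in>verts G. \<Sum>i\<in>{0..d}. 1 / real (card (face_at d G \<epsilon> v i)))"
proof -
  have "finite (bicolored_cycles G a b)" for a b
    using G unfolding bicolored_cycles_def quotient_def
    by (auto simp: regular_colored_graph_def bicolored_edges_def)
  then have "card (face_boundaries d G \<epsilon>) =
      (\<Sum>i\<in>{0..d}. card (bicolored_cycles G (\<epsilon> i) (\<epsilon> ((i + 1) mod (d + 1)))))"
    unfolding face_boundaries_def using bicolored_cycles_consecutive_disjoint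
    by (intro card_UN_disjoint) auto
  also have "real \<dots> = (\<Sum>i\<in>{0..d}. \<Sum>v\<in>verts G. 1 / real (card (face_at d G \<epsilon> v i)))"
    unfolding face_at_def of_nat_sum
    by (intro sum.cong refl card_bicolored_cycles[OF G] epsilon_le successor_le epsilon_successor_neq) auto
  also have "\<dots> = (\<Sum>v\<in>verts G. \<Sum>i\<in>{0..d}. 1 / real (card (face_at d G \<epsilon> v i)))"
    by (rule sum.swap)
  finally show ?thesis .
qed

lemma even_card_face_at:
  assumes "v \<in> verts G" "i \<le> d"
  shows "even (card (face_at d G \<epsilon> v i))"
  using card_bicolored_cycle(2)[OF G epsilon_le epsilon_le epsilon_successor_neq
      face_at_bicolored_cycle[OF assms]] assms(2) successor_le by blast

text \<open>Any two of three cyclically ordered faces are neighbors, so for \<open>d = 2\<close> the order of the list is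
  irrelevant and only the multiset of face lengths matters.\<close>
lemma face_cycle_permute:
  assumes d2: "d = 2" and P: "face_cycle d G \<epsilon> v P" and v: "v \<in> verts G" and "mset Q = mset P"
  shows "face_cycle d G \<epsilon> v Q"
proof -
  have set: "set Q = set P" and dist: "distinct Q"
    using mset_eq_setD[OF assms(4)] mset_eq_imp_distinct_iff[OF assms(4)] P
    by (simp_all add: face_cycle_def)
  have P': "set P = face_at d G \<epsilon> v ` {0..d}"
    using P faces_at_vertex[OF v] by (auto simp: face_cycle_def)
  have share: "\<exists>e \<in> C \<inter> D. v \<in> ends G e" if CD: "C \<in> set P" "D \<in> set P" for C D
  proof -
    obtain i j where ij: "i \<le> 2" "j \<le> 2" "C = face_at d G \<epsilon> v i" "D = face_at d G \<epsilon> v j"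
      using CD d2 unfolding P' by auto
    have "i = 0 \<or> i = 1 \<or> i = 2" "j = 0 \<or> j = 1 \<or> j = 2" using ij(1,2) by auto
    then consider "i = j" | "j = (i + 1) mod (d + 1)" | "i = (j + 1) mod (d + 1)"
      using d2 by (elim disjE) simp_all
    then show ?thesis
    proof cases
      case 1
      then show ?thesis
        using consecutive_faces_share_edge[OF v, of i] ij(1) d2 unfolding ij(3,4) by blast
    next
      case 2
      then show ?thesis
        using consecutive_faces_share_edge[OF v, of i] ij(1) d2 unfolding ij(3,4) by simp
    next
      case 3
      then show ?thesis
        using consecutive_faces_share_edge[OF v, of j] ij(2) d2 unfolding ij(3,4)
        by (simp add: Int_commute)
    qed
  qed
  have "\<exists>e \<in> Q ! i \<inter> Q ! ((i + 1) mod length Q). v \<in> ends G e" if "i < length Q" for i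
    using that set by (intro share) (auto intro!: nth_mem mod_less_divisor simp flip: set)
  then show ?thesis
    using P set dist unfolding face_cycle_def by simp
qed

lemma face_cycle_of_lengths:
  assumes "d = 2" and v: "v \<in> verts G" and P: "face_cycle d G \<epsilon> v P" and "mset p = mset (map card P)"
  obtains Q where "face_cycle d G \<epsilon> v Q" "map card Q = p"
proof -
  obtain f where f: "f permutes {..<length (map card P)}" "permute_list f (map card P) = p"
    using mset_eq_permutation[OF assms(4)] by blast
  show ?thesis
  proof (rule that[of "permute_list f P"])
    show "face_cycle d G \<epsilon> v (permute_list f P)"
      using face_cycle_permute[OF assms(1) P v] f(1) by simp
    show "map card (permute_list f P) = p"
      using f permute_list_map[of f P card] by simp
  qed
qed

end

lemma finite_face_boundaries:
  assumes "finite (edges G)"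
  shows "finite (face_boundaries d G \<epsilon>)"
proof -
  have "finite (bicolored_cycles G a b)" for a b
    unfolding bicolored_cycles_def quotient_def
    using assms by (auto simp: bicolored_edges_def)
  then show ?thesis by (auto simp: face_boundaries_def)
qed

lemma face_boundaries_subset_edges:
  assumes "C \<in> face_boundaries d G \<epsilon>"
  shows "C \<subseteq> edges G"
  using assms bicolored_cycle_subset by (force simp: face_boundaries_def bicolored_edges_def)

section \<open>The cell structure of a regularly embedded graph\<close>

lemma embedding_map_imp_continuous_map:
  assumes "embedding_map X Y f"
  shows "continuous_map X Y f"
  using assms homeomorphic_imp_continuous_map continuous_map_in_subtopology
  unfolding embedding_map_def by blast

lemma embedding_map_restrict:
  assumes "embedding_map X Y f"
  shows "embedding_map (subtopology X A) Y f"
proof -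
  have "homeomorphic_map (subtopology X A)
     (subtopology (subtopology Y (f ` topspace X)) (f ` (topspace X \<inter> A))) f"
    using assms unfolding embedding_map_def
    by (intro homeomorphic_map_subtopologies)
       (use assms continuous_map_image_subset_topspace homeomorphic_imp_continuous_map
         in \<open>auto simp: embedding_map_def dest!: homeomorphic_imp_surjective_map\<close>)
  moreover have "f ` topspace X \<inter> f ` (topspace X \<inter> A) = f ` topspace (subtopology X A)"
    by auto
  ultimately show ?thesis
    by (simp add: embedding_map_def subtopology_subtopology)
qed

lemma open_disc_subset_disc: "open_disc n \<subseteq> disc n"
  by (auto simp: open_disc_def disc_def)

lemma embedding_map_open_disc:
  assumes "embedding_map (subtopology (Euclidean_space n) (disc n)) X \<psi>"
  shows "embedding_map (subtopology (Euclidean_space n) (open_disc n)) X \<psi>"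
  using embedding_map_restrict[OF assms, of "open_disc n"] open_disc_subset_disc[of n]
  by (simp add: subtopology_subtopology inf_absorb2)

lemma disc_0: "disc 0 = {\<lambda>_. 0}" "open_disc 0 = {\<lambda>_. 0}" "disc_boundary 0 = {}"
  by (auto simp: disc_def open_disc_def disc_boundary_def topspace_Euclidean_space)

text \<open>The identification of the model disc in dimension 1, which is \<open>[-1, 1]\<close> on the coordinate axis,
  with the parameter interval \<open>[0, 1]\<close> of the arcs.\<close>
definition segment_coord :: "(nat \<Rightarrow> real) \<Rightarrow> real" where
  "segment_coord x = (x 0 + 1) / 2"

lemma homeomorphic_map_segment_coord:
  "homeomorphic_map (subtopology (Euclidean_space 1) (disc 1)) (top_of_set {0..1}) segment_coord"
proof -
  define g :: "real \<Rightarrow> nat \<Rightarrow> real" where "g t = (\<lambda>i. if i = 0 then 2 * t - 1 else 0)" for t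
  have eq: "subtopology (Euclidean_space 1) (disc 1) = subtopology (powertop_real UNIV) (disc 1)"
    by (auto simp: Euclidean_space_def subtopology_subtopology disc_def intro!: arg_cong2[where f=subtopology])
  have mem: "x \<in> disc 1 \<longleftrightarrow> (\<forall>i\<ge>1. x i = 0) \<and> - 1 \<le> x 0 \<and> x 0 \<le> 1" for x
    by (auto simp: disc_def topspace_Euclidean_space abs_square_le_1 abs_le_iff)
  have "continuous_map (subtopology (powertop_real UNIV) (disc 1)) euclideanreal (\<lambda>x. x 0)"
    by (rule continuous_map_from_subtopology) (rule continuous_map_product_projection, simp)
  then have 1: "continuous_map (subtopology (powertop_real UNIV) (disc 1)) (top_of_set {0..1}) segment_coord"
    unfolding segment_coord_def continuous_map_in_subtopology
    by (auto intro!: continuous_intros simp: mem simp del: One_nat_def)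
  have "continuous_map (top_of_set {0..1}) euclideanreal (\<lambda>t. g t i)" for i
    unfolding continuous_map_iff_continuous g_def by (cases "i = 0") (auto intro!: continuous_intros)
  then have 2: "continuous_map (top_of_set {0..1}) (subtopology (powertop_real UNIV) (disc 1)) g"
    unfolding continuous_map_in_subtopology continuous_map_componentwise_UNIV
    by (auto simp: mem g_def simp del: One_nat_def)
  have "homeomorphic_maps (subtopology (powertop_real UNIV) (disc 1)) (top_of_set {0..1}) segment_coord g"
    unfolding homeomorphic_maps_def using 1 2 by (auto simp: mem g_def segment_coord_def fun_eq_iff field_simps simp del: One_nat_def)
  then show ?thesis
    unfolding eq homeomorphic_map_maps by blast
qed

lemma segment_coord_image:
  "segment_coord ` open_disc 1 = {0<..<1}" "segment_coord ` disc_boundary 1 = {0, 1}"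
proof -
  have t: "segment_coord (\<lambda>i. if i = 0 then 2 * t - 1 else 0) = t" for t
    by (simp add: segment_coord_def)
  show "segment_coord ` open_disc 1 = {0<..<1}"
  proof (intro equalityI subsetI)
    fix t :: real assume "t \<in> {0<..<1}"
    then have "(\<lambda>i. if i = 0 then 2 * t - 1 else 0) \<in> open_disc 1"
      by (auto simp: open_disc_def topspace_Euclidean_space abs_square_less_1)
    then show "t \<in> segment_coord ` open_disc 1" using t by (metis imageI)
  qed (auto simp: open_disc_def topspace_Euclidean_space abs_square_less_1 segment_coord_def)
  show "segment_coord ` disc_boundary 1 = {0, 1}"
  proof (intro equalityI subsetI)
    fix t :: real assume "t \<in> {0, 1}"
    then have "(\<lambda>i. if i = 0 then 2 * t - 1 else 0) \<in> disc_boundary 1"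
      by (auto simp: disc_boundary_def topspace_Euclidean_space)
    then show "t \<in> segment_coord ` disc_boundary 1" using t by (metis imageI)
  qed (auto simp: disc_boundary_def topspace_Euclidean_space power2_eq_1_iff segment_coord_def)
qed

text \<open>The condition on a single cell \<open>c\<close> in a CW structure, \<open>B\<close> being the union of the cells of lower
  dimension.\<close>
definition has_characteristic_map :: "'s topology \<Rightarrow> nat \<Rightarrow> 's set \<Rightarrow> 's set \<Rightarrow> bool" where
  "has_characteristic_map X k c B \<longleftrightarrow>
     (\<exists>\<phi>. continuous_map (subtopology (Euclidean_space k) (disc k)) X \<phi> \<and>
        embedding_map (subtopology (Euclidean_space k) (open_disc k)) X \<phi> \<and>
        \<phi> ` open_disc k = c \<and> \<phi> ` disc_boundary k \<subseteq> B)"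

text \<open>All characteristic maps needed here are injective on the whole closed disc: arcs are embedded,
  and every region is the interior of an embedded closed disc.\<close>
lemma has_characteristic_map_embedding:
  assumes "embedding_map (subtopology (Euclidean_space k) (disc k)) X \<psi>"
    and "\<psi> ` open_disc k = c" and "\<psi> ` disc_boundary k \<subseteq> B"
  shows "has_characteristic_map X k c B"
  unfolding has_characteristic_map_def
  using assms embedding_map_open_disc embedding_map_imp_continuous_map by blast

lemma has_characteristic_map_point:
  assumes "x \<in> topspace X"
  shows "has_characteristic_map X 0 {x} B"
proof -
  have top: "topspace (subtopology (Euclidean_space 0) {\<lambda>_. 0}) = {\<lambda>_. 0}"
    by (auto simp: topspace_Euclidean_space)
  have "homeomorphic_map (subtopology (Euclidean_space 0) {\<lambda>_. 0}) (subtopology X {x}) (\<lambda>_. x)"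
    unfolding homeomorphic_map_maps homeomorphic_maps_def
    by (rule exI[of _ "\<lambda>_ _. 0"])
       (use assms top in \<open>auto simp: continuous_map_in_subtopology topspace_Euclidean_space\<close>)
  then have "embedding_map (subtopology (Euclidean_space 0) (disc 0)) X (\<lambda>_. x)"
    unfolding embedding_map_def disc_0 top by simp
  then show ?thesis
    by (rule has_characteristic_map_embedding) (auto simp: disc_0)
qed

lemma has_characteristic_map_arc:
  fixes \<gamma> :: "real \<Rightarrow> 's"
  assumes "embedding_map (top_of_set {0..1}) X \<gamma>" and "{\<gamma> 0, \<gamma> 1} \<subseteq> B"
  shows "has_characteristic_map X 1 (\<gamma> ` {0<..<1}) B"
proof (rule has_characteristic_map_embedding)
  show "embedding_map (subtopology (Euclidean_space 1) (disc 1)) X (\<gamma> \<circ> segment_coord)"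
  proof (rule embedding_map_compose[OF _ assms(1)])
    show "embedding_map (subtopology (Euclidean_space 1) (disc 1)) (top_of_set {0..1}) segment_coord"
      unfolding embedding_map_def homeomorphic_imp_surjective_map[OF homeomorphic_map_segment_coord]
        subtopology_topspace by (rule homeomorphic_map_segment_coord)
  qed
  show "(\<gamma> \<circ> segment_coord) ` open_disc 1 = \<gamma> ` {0<..<1}"
    "(\<gamma> \<circ> segment_coord) ` disc_boundary 1 \<subseteq> B"
    unfolding image_comp[symmetric] segment_coord_image using assms(2) by simp_all
qed

definition embedding_cells ::
  "('v, 'e) colored_graph \<Rightarrow> 's topology \<Rightarrow> ('v \<Rightarrow> 's) \<Rightarrow> ('e \<Rightarrow> real \<Rightarrow> 's) \<Rightarrow> (nat \<times> 's set) set"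
  where
  "embedding_cells G S \<phi> \<eta> =
     (\<lambda>v. (0, {\<phi> v})) ` verts G \<union> (\<lambda>e. (1, \<eta> e ` {0<..<1})) ` edges G \<union> Pair 2 ` regions G S \<eta>"

lemma embedded_edges_decomposition:
  assumes "regular_colored_graph d G" and "graph_embedding G S \<phi> \<eta>" and "C \<subseteq> edges G"
  shows "embedded_edges \<eta> C = (\<Union>e\<in>C. \<eta> e ` {0<..<1}) \<union> \<phi> ` (\<Union>e\<in>C. ends G e)"
proof -
  have "\<eta> e ` {0..1} = \<eta> e ` {0<..<1} \<union> \<phi> ` ends G e" if "e \<in> C" for e
  proof -
    have closed: "{0..1::real} = {0<..<1} \<union> {0, 1}" by auto
    have "\<eta> e ` {0..1} = \<eta> e ` {0<..<1} \<union> {\<eta> e 0, \<eta> e 1}"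
      unfolding closed image_Un by simp
    moreover have "{\<eta> e 0, \<eta> e 1} = \<phi> ` ends G e"
      using assms(2) subsetD[OF assms(3) that] by (simp add: graph_embedding_def)
    ultimately show ?thesis by simp
  qed
  then show ?thesis by (auto simp: embedded_edges_def)
qed

lemma embedded_graph_decomposition:
  assumes "regular_colored_graph d G" and "graph_embedding G S \<phi> \<eta>"
  shows "embedded_edges \<eta> (edges G) = (\<Union>e\<in>edges G. \<eta> e ` {0<..<1}) \<union> \<phi> ` verts G"
proof -
  have "(\<Union>e\<in>edges G. ends G e) = verts G"
  proof (intro equalityI subsetI)
    fix v assume "v \<in> verts G"
    then show "v \<in> (\<Union>e\<in>edges G. ends G e)"
      using vertex_on_edge[OF assms(1)] by blast
  qed (use regular_colored_graph_ends(1)[OF assms(1)] in blast)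
  then show ?thesis using embedded_edges_decomposition[OF assms] by simp
qed

text \<open>The regions are the components of the complement of the graph, so together with the vertices
  and open arcs they partition the surface. There are finitely many, as they correspond to the
  bi-colored cycles, and the closed disc bounded by such a cycle is attached along arcs of the graph.\<close>
lemma finite_cw_structure_embedding_cells:
  assumes G: "regular_colored_graph d G" and emb: "regular_embedding d G S \<epsilon> \<phi> \<eta>"
  shows "finite_cw_structure S (embedding_cells G S \<phi> \<eta>)"
proof -
  let ?\<C> = "embedding_cells G S \<phi> \<eta>"
  let ?A = "embedded_edges \<eta> (edges G)"
  have S: "closed_surface S" and ge: "graph_embedding G S \<phi> \<eta>"
    using emb by (auto simp: regular_embedding_def)
  obtain F where F: "bij_betw F (face_boundaries d G \<epsilon>) (regions G S \<eta>)"
    and cell: "\<And>C. C \<in> face_boundaries d G \<epsilon> \<Longrightarrow> cell_bounded_by S (F C) (embedded_edges \<eta> C)"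
    using emb by (auto simp: regular_embedding_def)
  have fin: "finite (verts G)" "finite (edges G)"
    using G by (auto simp: regular_colored_graph_def)
  have finR: "finite (regions G S \<eta>)"
    using F finite_face_boundaries[OF fin(2)] bij_betw_finite by blast
  note dec = embedded_graph_decomposition[OF G ge]
  have vS: "\<phi> ` verts G \<subseteq> topspace S"
    and arc: "\<And>e. e \<in> edges G \<Longrightarrow> embedding_map (top_of_set {0..1}) S (\<eta> e)"
    and arc_ends: "\<And>e. e \<in> edges G \<Longrightarrow> {\<eta> e 0, \<eta> e 1} = \<phi> ` ends G e"
    and arc_verts: "\<And>e. e \<in> edges G \<Longrightarrow> \<eta> e ` {0<..<1} \<inter> \<phi> ` verts G = {}"
    and arcs: "\<And>e f. \<lbrakk>e \<in> edges G; f \<in> edges G; e \<noteq> f\<rbrakk> \<Longrightarrow> \<eta> e ` {0<..<1} \<inter> \<eta> f ` {0<..<1} = {}"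
    using ge by (auto simp: graph_embedding_def)
  have ends: "\<And>e. e \<in> edges G \<Longrightarrow> ends G e \<subseteq> verts G"
    using G by (auto simp: regular_colored_graph_def)
  have arcS: "\<eta> e ` {0..1} \<subseteq> topspace S" if "e \<in> edges G" for e
    using embedding_map_imp_continuous_map[OF arc[OF that]] continuous_map_image_subset_topspace
    by (metis topspace_euclidean_subtopology)
  have AS: "?A \<subseteq> topspace S"
    using arcS by (auto simp: embedded_edges_def)
  have UR: "\<Union>(regions G S \<eta>) = topspace S - ?A"
    by (auto simp: regions_def Union_connected_components_of)
  have "\<Union>(snd ` ?\<C>) = ?A \<union> \<Union>(regions G S \<eta>)"
    unfolding dec embedding_cells_def by (auto simp: image_Un image_image)
  then have cover: "(\<Union>(k, c)\<in>?\<C>. c) = topspace S"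
    using UR AS by (auto simp: case_prod_beta)
  have region: "c \<inter> ?A = {}" if "c \<in> regions G S \<eta>" for c
    using that UR by blast
  have vr: "\<phi> v \<notin> c" if "v \<in> verts G" "c \<in> regions G S \<eta>" for v c
    using region[OF that(2)] that(1) unfolding dec by blast
  have er: "\<eta> e ` {0<..<1} \<inter> c = {}" if "e \<in> edges G" "c \<in> regions G S \<eta>" for e c
    using region[OF that(2)] that(1) unfolding dec by blast
  have rr: "c \<inter> c' = {}" if "c \<in> regions G S \<eta>" "c' \<in> regions G S \<eta>" "c \<noteq> c'" for c c'
    using pairwiseD[OF pairwise_disjoint_connected_components_of] that
    unfolding regions_def by (simp add: disjnt_def)
  define is_cell where "is_cell k c \<longleftrightarrow> (k = 0 \<and> (\<exists>v\<in>verts G. c = {\<phi> v})) \<or>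
    (k = 1 \<and> (\<exists>e\<in>edges G. c = \<eta> e ` {0<..<1})) \<or> (k = 2 \<and> c \<in> regions G S \<eta>)" for k :: nat and c
  have is_cell: "(k, c) \<in> ?\<C> \<longleftrightarrow> is_cell k c" for k c
    by (auto simp: is_cell_def embedding_cells_def)
  \<comment> \<open>By symmetry it suffices to treat pairs of cells with \<open>k \<le> l\<close>.\<close>
  have disj_le: "c \<inter> c' = {}" if cc: "is_cell k c" "is_cell l c'" "(k, c) \<noteq> (l, c')" "k \<le> l" for k c l c'
  proof -
    have dims: "(k, l) \<in> {(0, 0), (0, 1), (0, 2), (1, 1), (1, 2), (2, 2)}"
      using cc(1,2,4) by (auto simp: is_cell_def)
    then consider "k = 0" "l = 0" | "k = 0" "l = 1" | "k = 0" "l = 2"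
      | "k = 1" "l = 1" | "k = 1" "l = 2" | "k = 2" "l = 2" by auto
    then show ?thesis
    proof cases
      case 2
      then obtain v e where "v \<in> verts G" "c = {\<phi> v}" "e \<in> edges G" "c' = \<eta> e ` {0<..<1}"
        using cc by (auto simp: is_cell_def)
      then show ?thesis using arc_verts by blast
    next
      case 4
      then obtain e f where "e \<in> edges G" "c = \<eta> e ` {0<..<1}" "f \<in> edges G" "c' = \<eta> f ` {0<..<1}"
        using cc by (auto simp: is_cell_def)
      then show ?thesis using arcs 4 cc(3) by blast
    next
      case 5
      then obtain e where "e \<in> edges G" "c = \<eta> e ` {0<..<1}" "c' \<in> regions G S \<eta>"
        using cc by (auto simp: is_cell_def)
      then show ?thesis using er by blast
    qed (use cc rr vr in \<open>auto simp: is_cell_def\<close>)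
  qed
  have disj: "c \<inter> c' = {}" if "(k, c) \<in> ?\<C>" "(l, c') \<in> ?\<C>" "(k, c) \<noteq> (l, c')" for k c l c'
    using disj_le[of k c l c'] disj_le[of l c' k c] that unfolding is_cell by (metis Int_commute linear)
  have cells: "has_characteristic_map S k c (\<Union>{c'. \<exists>l<k. (l, c') \<in> ?\<C>})" if kc: "(k, c) \<in> ?\<C>" for k c
  proof -
    have v0: "(0, {\<phi> v}) \<in> ?\<C>" if "v \<in> verts G" for v
      using that by (auto simp: embedding_cells_def)
    have e1: "(1, \<eta> e ` {0<..<1}) \<in> ?\<C>" if "e \<in> edges G" for e
      using that by (auto simp: embedding_cells_def)
    consider v where "v \<in> verts G" "k = 0" "c = {\<phi> v}"
      | e where "e \<in> edges G" "k = 1" "c = \<eta> e ` {0<..<1}"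
      | "c \<in> regions G S \<eta>" "k = 2"
      using kc by (auto simp: embedding_cells_def)
    then show ?thesis
    proof cases
      case 1
      then show ?thesis using vS by (auto intro: has_characteristic_map_point)
    next
      case 2
      have "\<phi> ` ends G e \<subseteq> \<Union>{c'. \<exists>l<1. (l, c') \<in> ?\<C>}"
        using ends[OF 2(1)] v0 by blast
      then show ?thesis
        unfolding 2 using arc[OF 2(1)] arc_ends[OF 2(1)] by (intro has_characteristic_map_arc) auto
    next
      case 3
      then obtain C where C: "C \<in> face_boundaries d G \<epsilon>" "c = F C"
        using F by (auto simp: bij_betw_def)
      obtain \<psi> where \<psi>: "embedding_map (subtopology (Euclidean_space 2) (disc 2)) S \<psi>"
        "\<psi> ` open_disc 2 = c" "\<psi> ` disc_boundary 2 = embedded_edges \<eta> C"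
        using cell[OF C(1)] C(2) by (auto simp: cell_bounded_by_def)
      have "embedded_edges \<eta> C \<subseteq> ?A"
        using face_boundaries_subset_edges[OF C(1)] by (auto simp: embedded_edges_def)
      also have "?A \<subseteq> \<Union>{c'. \<exists>l<2. (l, c') \<in> ?\<C>}"
      proof
        fix x assume "x \<in> ?A"
        then consider e where "e \<in> edges G" "x \<in> \<eta> e ` {0<..<1}" | v where "v \<in> verts G" "x = \<phi> v"
          unfolding dec by blast
        then show "x \<in> \<Union>{c'. \<exists>l<2. (l, c') \<in> ?\<C>}"
        proof cases
          case 1
          then show ?thesis using e1 one_less_numeral_iff semiring_norm(76) by blast
        next
          case 2
          then show ?thesis using v0 zero_less_numeral by blast
        qed
      qed
      finally show ?thesis
        unfolding 3(2) using has_characteristic_map_embedding[OF \<psi>(1,2)] \<psi>(3) by simp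
    qed
  qed
  have "finite ?\<C>"
    using fin finR by (simp add: embedding_cells_def)
  moreover have "Hausdorff_space S"
    using S by (simp add: closed_surface_def)
  moreover have "\<forall>(k, c)\<in>?\<C>. \<forall>(l, c')\<in>?\<C>. (k, c) \<noteq> (l, c') \<longrightarrow> c \<inter> c' = {}"
  proof -
    have "snd x \<inter> snd y = {}" if "x \<in> ?\<C>" "y \<in> ?\<C>" "x \<noteq> y" for x y
      using disj[of "fst x" "snd x" "fst y" "snd y"] that by simp
    then show ?thesis by fastforce
  qed
  moreover have "\<forall>(k, c)\<in>?\<C>. has_characteristic_map S k c (\<Union>{c'. \<exists>l<k. (l, c') \<in> ?\<C>})"
    using cells by (intro ballI) (clarify, simp)
  ultimately show ?thesis
    using cover unfolding finite_cw_structure_def has_characteristic_map_def by simp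
qed

text \<open>Different vertices, edges and bi-colored cycles give different cells, because the embedding is
  injective and open arcs are nonempty and disjoint. Hence the alternating sum of cells counts the
  combinatorial objects.\<close>
lemma euler_sum_embedding_cells:
  assumes G: "regular_colored_graph d G" and emb: "regular_embedding d G S \<epsilon> \<phi> \<eta>"
  shows "(\<Sum>(k, c)\<in>embedding_cells G S \<phi> \<eta>. (- 1) ^ k) =
    int (card (verts G)) - int (card (edges G)) + int (card (face_boundaries d G \<epsilon>))"
proof -
  have ge: "graph_embedding G S \<phi> \<eta>"
    using emb by (auto simp: regular_embedding_def)
  obtain F where F: "bij_betw F (face_boundaries d G \<epsilon>) (regions G S \<eta>)"
    using emb by (auto simp: regular_embedding_def)
  have fin: "finite (verts G)" "finite (edges G)"
    using G by (auto simp: regular_colored_graph_def)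
  have finR: "finite (regions G S \<eta>)"
    using F finite_face_boundaries[OF fin(2)] bij_betw_finite by blast
  have iv: "inj_on (\<lambda>v. (0::nat, {\<phi> v})) (verts G)"
    using ge by (auto simp: graph_embedding_def inj_on_def)
  have ie: "inj_on (\<lambda>e. (1::nat, \<eta> e ` {0<..<1})) (edges G)"
  proof (rule inj_onI)
    fix e f assume ef: "e \<in> edges G" "f \<in> edges G" "(1::nat, \<eta> e ` {0<..<1}) = (1, \<eta> f ` {0<..<1})"
    then have "\<eta> e ` {0<..<1} \<inter> \<eta> f ` {0<..<1} \<noteq> {}"
      using greaterThanLessThan_empty_iff[of "0::real" 1] by auto
    then show "e = f"
      using ge ef(1,2) unfolding graph_embedding_def by blast
  qed
  let ?V = "(\<lambda>v. (0::nat, {\<phi> v})) ` verts G" and ?E = "(\<lambda>e. (1::nat, \<eta> e ` {0<..<1})) ` edges G"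
    and ?R = "Pair (2::nat) ` regions G S \<eta>"
  let ?s = "\<lambda>(k, c :: 'd set). (- 1 :: int) ^ k"
  have "sum ?s (?V \<union> ?E \<union> ?R) = sum ?s ?V + sum ?s ?E + sum ?s ?R"
    using fin finR by (subst sum.union_disjoint, auto)+
  also have "sum ?s ?V = int (card (verts G))"
    by (simp add: sum.reindex[OF iv])
  also have "sum ?s ?E = - int (card (edges G))"
    by (simp add: sum.reindex[OF ie] del: One_nat_def)
  also have "sum ?s ?R = int (card (face_boundaries d G \<epsilon>))"
    using bij_betw_same_card[OF F] by (simp add: sum.reindex inj_on_def)
  finally show ?thesis
    by (simp add: embedding_cells_def)
qed

section \<open>Face lengths with unit fractions summing to one half\<close>

lemma same_cyclic_type_imp_mset_eq:
  assumes "same_cyclic_type p q"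
  shows "mset q = mset p"
proof -
  have "mset (rotate1 xs) = mset xs" for xs :: "nat list"
    by (cases xs) simp_all
  then have "mset (rotate n xs) = mset xs" for n and xs :: "nat list"
    by (induction n) simp_all
  then show ?thesis using assms by (auto simp: same_cyclic_type_def)
qed

text \<open>The largest of the fractions is at least their average \<open>1/6\<close>, so \<open>p\<close> is 4 or 6. The same argument
  for the remaining two fractions bounds \<open>q\<close>, and then \<open>r\<close> is determined. Parity excludes the solutions
  \<open>(5, 5, 10)\<close> and \<open>(4, 5, 20)\<close>.\<close>
lemma unit_fractions_sum_half_sorted:
  fixes p q r :: nat
  assumes even: "even p" "even q" "even r" and "4 \<le> p" "p \<le> q" "q \<le> r"
    and sum: "1 / real p + 1 / real q + 1 / real r = 1 / 2"
  shows "p = 6 \<and> q = 6 \<and> r = 6 \<or> p = 4 \<and> q = 8 \<and> r = 8 \<or> p = 4 \<and> q = 6 \<and> r = 12"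
proof -
  have le: "1 / real q \<le> 1 / real p" "1 / real r \<le> 1 / real q"
    using assms by (auto intro!: frac_le)
  then have "1 / 6 \<le> 1 / real p" using sum by linarith
  then have "p \<le> 6" using assms by (simp add: field_simps)
  then have "p = 4 \<or> p = 5 \<or> p = 6" using assms by auto
  then consider "p = 4" | "p = 6" using even(1) by auto
  then show ?thesis
  proof cases
    case 1
    then have qr: "1 / real q + 1 / real r = 1 / 4" using sum by simp
    then have "1 / 8 \<le> 1 / real q" using le by linarith
    then have "q \<le> 8" using assms by (simp add: field_simps)
    then have "q = 4 \<or> q = 5 \<or> q = 6 \<or> q = 7 \<or> q = 8" using assms by auto
    then consider "q = 4" | "q = 6" | "q = 8" using even(2) by auto
    then show ?thesis
    proof cases
      case 2
      have "1 / real r = 1 / 4 - 1 / real q" using qr by linarith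
      also have "\<dots> = 1 / 12" using 2 by simp
      finally have "r = 12" by simp
      then show ?thesis using 1 2 by simp
    next
      case 3
      have "1 / real r = 1 / 4 - 1 / real q" using qr by linarith
      also have "\<dots> = 1 / 8" using 3 by simp
      finally have "r = 8" by simp
      then show ?thesis using 1 3 by simp
    qed (use qr assms in simp)
  next
    case 2
    then have qr: "1 / real q + 1 / real r = 1 / 3" using sum by simp
    then have "1 / 6 \<le> 1 / real q" using le by linarith
    then have "q = 6" using assms 2 by (simp add: field_simps)
    have "1 / real r = 1 / 3 - 1 / real q" using qr by linarith
    also have "\<dots> = 1 / 6" using \<open>q = 6\<close> by simp
    finally have "r = 6" by simp
    then show ?thesis using 2 \<open>q = 6\<close> by simp
  qed
qed

lemma unit_fractions_sum_half:
  fixes p q r :: nat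
  assumes "even p" "even q" "even r" and "4 \<le> p" "4 \<le> q" "4 \<le> r"
    and "1 / real p + 1 / real q + 1 / real r = 1 / 2"
  shows "mset [p, q, r] \<in> {mset [6, 6, 6], mset [8, 8, 4], mset [4, 6, 12]}"
proof -
  consider "p \<le> q" "q \<le> r" | "p \<le> r" "r \<le> q" | "q \<le> p" "p \<le> r"
    | "q \<le> r" "r \<le> p" | "r \<le> p" "p \<le> q" | "r \<le> q" "q \<le> p" by linarith
  then show ?thesis
  proof cases
    case 1
    then show ?thesis using unit_fractions_sum_half_sorted[of p q r] assms by auto
  next
    case 2
    then show ?thesis using unit_fractions_sum_half_sorted[of p r q] assms by auto
  next
    case 3
    then show ?thesis using unit_fractions_sum_half_sorted[of q p r] assms by auto
  next
    case 4
    then show ?thesis using unit_fractions_sum_half_sorted[of q r p] assms by auto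
  next
    case 5
    then show ?thesis using unit_fractions_sum_half_sorted[of r p q] assms by auto
  next
    case 6
    then show ?thesis using unit_fractions_sum_half_sorted[of r q p] assms by auto
  qed
qed

section \<open>Types of semi-equivelar gems on surfaces of Euler characteristic zero\<close>

text \<open>The combinatorial data that a semi-equivelar gem on a surface of Euler characteristic zero
  provides; the topology enters only through \<open>V - E + F = 0\<close>.\<close>
context
  fixes d :: nat and G :: "('v, 'e) colored_graph" and \<epsilon> :: "nat \<Rightarrow> nat"
  assumes d: "d \<ge> 2" and G: "regular_colored_graph d G" and \<epsilon>: "bij_betw \<epsilon> {0..d} {0..d}"
    and euler: "int (card (verts G)) - int (card (edges G)) + int (card (face_boundaries d G \<epsilon>)) = 0"
    and ge4: "\<forall>C\<in>face_boundaries d G \<epsilon>. card C \<ge> 4"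
    and same: "\<forall>u\<in>verts G. \<forall>v\<in>verts G. \<forall>P Q. face_cycle d G \<epsilon> u P \<and> face_cycle d G \<epsilon> v Q \<longrightarrow>
        same_cyclic_type (map card P) (map card Q)"
begin

lemma face_lengths_mset_eq:
  assumes "u \<in> verts G" "v \<in> verts G"
  shows "mset (map card (map (face_at d G \<epsilon> u) [0..<d + 1])) =
    mset (map card (map (face_at d G \<epsilon> v) [0..<d + 1]))"
  using same[rule_format, OF assms conjI] face_cycle_face_at[OF d G \<epsilon>] assms
  by (intro same_cyclic_type_imp_mset_eq[symmetric]) blast

lemma inverse_length_sum_constant:
  assumes "u \<in> verts G" "v \<in> verts G"
  shows "(\<Sum>i\<in>{0..d}. 1 / real (card (face_at d G \<epsilon> u i))) =
    (\<Sum>i\<in>{0..d}. 1 / real (card (face_at d G \<epsilon> v i)))"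
proof -
  let ?L = "\<lambda>v. map card (map (face_at d G \<epsilon> v) [0..<d + 1])"
  have sum: "(\<Sum>i\<in>{0..d}. 1 / real (card (face_at d G \<epsilon> v i))) =
      sum_mset (image_mset (\<lambda>n. 1 / real n) (mset (?L v)))" for v
    unfolding mset_map[symmetric] sum_mset_sum_list map_map interv_sum_list_conv_sum_set_nat
    by (simp only: Suc_eq_plus1[symmetric] set_upt atLeastLessThanSuc_atLeastAtMost o_def)
  show ?thesis unfolding sum face_lengths_mset_eq[OF assms] ..
qed

text \<open>Dividing \<open>V - (d + 1) V / 2 + V s = 0\<close> by \<open>V\<close> determines the common value \<open>s\<close> of the sums.\<close>
lemma inverse_length_sum:
  assumes v: "v \<in> verts G"
  shows "(\<Sum>i\<in>{0..d}. 1 / real (card (face_at d G \<epsilon> v i))) = (real d - 1) / 2"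
proof -
  let ?s = "\<lambda>v. \<Sum>i\<in>{0..d}. 1 / real (card (face_at d G \<epsilon> v i))"
  have "real (card (face_boundaries d G \<epsilon>)) = (\<Sum>u\<in>verts G. ?s u)"
    by (rule card_face_boundaries[OF d G \<epsilon>])
  also have "\<dots> = (\<Sum>u\<in>verts G. ?s v)"
    by (intro sum.cong refl inverse_length_sum_constant v)
  finally have F: "real (card (face_boundaries d G \<epsilon>)) = real (card (verts G)) * ?s v"
    by simp
  have E: "2 * real (card (edges G)) = (real d + 1) * real (card (verts G))"
    using arg_cong[OF card_edges[OF G], of real] by (simp add: algebra_simps)
  have "real (card (verts G)) - real (card (edges G)) + real (card (face_boundaries d G \<epsilon>)) = 0"
    using arg_cong[OF euler, of real_of_int] by simp
  then have "real (card (verts G)) * (2 * ?s v - (real d - 1)) = 0"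
    using E unfolding F by (simp add: algebra_simps)
  moreover have "card (verts G) \<noteq> 0"
    using G v by (auto simp: regular_colored_graph_def)
  ultimately show ?thesis by simp
qed

lemma card_face_at_ge:
  assumes "v \<in> verts G" "i \<le> d"
  shows "card (face_at d G \<epsilon> v i) \<ge> 4" "1 / real (card (face_at d G \<epsilon> v i)) \<le> 1 / 4"
proof -
  show "card (face_at d G \<epsilon> v i) \<ge> 4"
    using ge4 face_at_face_boundary[OF d G \<epsilon> assms] by blast
  then show "1 / real (card (face_at d G \<epsilon> v i)) \<le> 1 / 4"
    by (intro frac_le) auto
qed

text \<open>Faces of length at least 4 give \<open>(d - 1) / 2 \<le> (d + 1) / 4\<close>.\<close>
lemma dimension_le_3: "d \<le> 3"
proof -
  obtain v where v: "v \<in> verts G" using verts_nonempty[OF G] by blast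
  have "(\<Sum>i\<in>{0..d}. 1 / real (card (face_at d G \<epsilon> v i))) \<le> (\<Sum>i\<in>{0..d}. 1 / 4)"
    using card_face_at_ge[OF v] by (intro sum_mono) auto
  then have "(real d - 1) / 2 \<le> (real d + 1) / 4"
    unfolding inverse_length_sum[OF v] by simp
  then show ?thesis by simp
qed

text \<open>Here the bound on the sum is attained, which forces all four fractions to be \<open>1 / 4\<close>.\<close>
lemma of_type_squares:
  assumes d3: "d = 3"
  shows "of_type d G \<epsilon> [4, 4, 4, 4]"
  unfolding of_type_def
proof
  fix v assume v: "v \<in> verts G"
  let ?c = "\<lambda>i. 1 / real (card (face_at d G \<epsilon> v i))"
  have "{0..d} = {0, 1, 2, 3}" using d3 by auto
  then have "?c 0 + ?c 1 + ?c 2 + ?c 3 = 1"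
    using inverse_length_sum[OF v] d3 by simp
  then have "1 / 4 \<le> ?c i" if "i \<in> {0, 1, 2, 3}" for i
    using card_face_at_ge(2)[OF v, of 0] card_face_at_ge(2)[OF v, of 1]
      card_face_at_ge(2)[OF v, of 2] card_face_at_ge(2)[OF v, of 3] d3 that by auto
  then have "card (face_at d G \<epsilon> v i) \<le> 4" if "i \<in> {0, 1, 2, 3}" for i
    using that card_face_at_ge(1)[OF v, of i] d3 by (force simp: field_simps)
  then have four: "card (face_at d G \<epsilon> v i) = 4" if "i \<in> {0, 1, 2, 3}" for i
    using that card_face_at_ge(1)[OF v, of i] d3 by (intro le_antisym) auto
  have "[0..<d + 1] = [0, 1, 2, 3]"
    by (simp add: d3 eval_nat_numeral)
  then have "map card (map (face_at d G \<epsilon> v) [0..<d + 1]) = [4, 4, 4, 4]"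
    by (simp only: list.map four insert_iff simp_thms)
  then show "\<exists>P. face_cycle d G \<epsilon> v P \<and> map card P = [4, 4, 4, 4]"
    using face_cycle_face_at[OF d G \<epsilon> v] by (intro exI conjI)
qed

text \<open>The multiset of lengths at one vertex is one of the three solutions, and it is the same at all
  vertices. As three faces may be listed in any order, the type can be attained literally.\<close>
lemma of_type_triples:
  assumes d2: "d = 2"
  shows "of_type d G \<epsilon> [6, 6, 6] \<or> of_type d G \<epsilon> [8, 8, 4] \<or> of_type d G \<epsilon> [4, 6, 12]"
proof -
  obtain u where u: "u \<in> verts G" using verts_nonempty[OF G] by blast
  let ?n = "\<lambda>v i. card (face_at d G \<epsilon> v i)" and ?P = "\<lambda>v. map (face_at d G \<epsilon> v) [0..<d + 1]"
  have "[0..<d + 1] = [0, 1, 2]"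
    by (simp add: d2 eval_nat_numeral)
  then have L: "map card (?P v) = [?n v 0, ?n v 1, ?n v 2]" for v
    by (simp only: list.map)
  have "{0..d} = {0, 1, 2}" using d2 by auto
  then have "1 / real (?n u 0) + 1 / real (?n u 1) + 1 / real (?n u 2) = 1 / 2"
    using inverse_length_sum[OF u] d2 by simp
  then have "mset (map card (?P u)) \<in> {mset [6, 6, 6], mset [8, 8, 4], mset [4, 6, 12]}"
    unfolding L using card_face_at_ge(1)[OF u] even_card_face_at[OF d G \<epsilon> u] d2
    by (intro unit_fractions_sum_half) auto
  moreover have "of_type d G \<epsilon> p" if p: "mset (map card (?P u)) = mset p" for p
    unfolding of_type_def
  proof
    fix v assume v: "v \<in> verts G"
    have "mset p = mset (map card (?P v))"
      using p face_lengths_mset_eq[OF u v] by simp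
    then obtain Q where "face_cycle d G \<epsilon> v Q" "map card Q = p"
      by (rule face_cycle_of_lengths[OF d G \<epsilon> d2 v face_cycle_face_at[OF d G \<epsilon> v]])
    then show "\<exists>P. face_cycle d G \<epsilon> v P \<and> map card P = p" by blast
  qed
  ultimately show ?thesis by (elim insertE emptyE) simp_all
qed

end

theorem proposition3:
  fixes d :: nat
    and G :: "('v, 'e) colored_graph"
    and M :: "'m::euclidean_space set"
    and S :: "'s topology"
    and \<epsilon> :: "nat \<Rightarrow> nat"
    and \<phi> :: "'v \<Rightarrow> 's"
    and \<eta> :: "'e \<Rightarrow> real \<Rightarrow> 's"
  assumes "d \<ge> 2"
    and "semi_equivelar_gem d G M S \<epsilon> \<phi> \<eta>"
    and "has_euler_characteristic S 0"
  shows "of_type d G \<epsilon> [4, 4, 4, 4] \<or> of_type d G \<epsilon> [6, 6, 6] \<or>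
    of_type d G \<epsilon> [8, 8, 4] \<or> of_type d G \<epsilon> [4, 6, 12]"
proof -
  have G: "regular_colored_graph d G" and emb: "regular_embedding d G S \<epsilon> \<phi> \<eta>"
    and ge4: "\<forall>C\<in>face_boundaries d G \<epsilon>. card C \<ge> 4"
    and same: "\<forall>u\<in>verts G. \<forall>v\<in>verts G. \<forall>P Q. face_cycle d G \<epsilon> u P \<and> face_cycle d G \<epsilon> v Q \<longrightarrow>
        same_cyclic_type (map card P) (map card Q)"
    using assms(2) unfolding semi_equivelar_gem_def gem_of_def by blast+
  have \<epsilon>: "bij_betw \<epsilon> {0..d} {0..d}"
    using emb by (simp add: regular_embedding_def)
  have "(\<Sum>(k, c)\<in>embedding_cells G S \<phi> \<eta>. (- 1 :: int) ^ k) = 0"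
    using assms(3) finite_cw_structure_embedding_cells[OF G emb]
    unfolding has_euler_characteristic_def by blast
  then have euler: "int (card (verts G)) - int (card (edges G)) + int (card (face_boundaries d G \<epsilon>)) = 0"
    unfolding euler_sum_embedding_cells[OF G emb] .
  note ctxt = assms(1) G \<epsilon> euler ge4 same
  have "d = 2 \<or> d = 3"
    using dimension_le_3[OF ctxt] assms(1) by auto
  then show ?thesis
    using of_type_triples[OF ctxt] of_type_squares[OF ctxt] by blast
qed

end
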